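(* Let $\alpha,\beta,\delta$ be real numbers such that $0\leq \alpha<1<\beta$ and $0\le\delta<1$, let $g\in\mathcal{S}(\delta,\beta)$, let $\rho\in\mathbb{R}\setminus(-\infty,-1]$, and let $f\in\mathcal{A}$ be given by $f(z)=z+\sum_{n=2}^{\infty}a_nz^n$. If $f\in\mathcal{B}_g(\alpha,\beta;\rho)$, then for every integer $n\ge 2$, $$|a_n|\leq \left\{\frac{\prod_{k=2}^{n}\left[k-2+\frac{2(\beta-\delta)}{\pi}\sin\frac{\pi(1-\delta)}{\beta-\delta}\right]}{n!}+\frac{2(\beta-\alpha)}{n\pi}\sin\frac{\pi(1-\alpha)}{\beta-\alpha}\left(1+\sum_{j=1}^{n-2}\frac{\prod_{k=2}^{n-j}\left[k-2+\frac{2(\beta-\delta)}{\pi}\sin\frac{\pi(1-\delta)}{\beta-\delta}\right]}{(n-j-1)!}\right)\right\}\times\frac{(1+\rho)(2+\rho)}{(n+\rho)(n+1+\rho)}.$$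
   Context: $\mathbb{U}=\{z\in\mathbb{C}:|z|<1\}$ is the open unit disk. $\mathcal{A}$ is the class of functions $f(z)=z+\sum_{n=2}^\infty a_nz^n$ analytic in $\mathbb{U}$. For real $\delta<1<\beta$, $\mathcal{S}(\delta,\beta)$ is the class of functions $g\in\mathcal{A}$ satisfying $\delta<\Re\left(\frac{zg'(z)}{g(z)}\right)<\beta$ for all $z\in\mathbb{U}$ (the quotient is taken to have value $1$ at $z=0$). For real $\alpha,\beta,\delta$ with $0\le\alpha<1<\beta$ and $0\le\delta<1$, and for $g\in\mathcal{S}(\delta,\beta)$, $\mathcal{S}_g(\alpha,\beta)$ is the class of functions $\varphi\in\mathcal{A}$ satisfying $\alpha<\Re\left(\frac{z\varphi'(z)}{g(z)}\right)<\beta$ for all $z\in\mathbb{U}$ (the quotient is taken to have value $1$ at $z=0$). For such $\alpha,\beta,\delta,g$ and $\rho\in\mathbb{R}\setminus(-\infty,-1]$, $\mathcal{B}_g(\alpha,\beta;\rho)$ is the class of functions $f\in\mathcal{A}$ for which there is $\varphi\in\mathcal{S}_g(\alpha,\beta)$ such that $w=f(z)$ satisfies the non-homogeneous Cauchy-Euler differential equation $$z^2\frac{d^2w}{dz^2}+2(1+\rho)z\frac{dw}{dz}+\rho(1+\rho)w=(1+\rho)(2+\rho)\varphi(z)\qquad(z\in\mathbb{U}).$$ Empty sums (e.g. $\sum_{j=1}^{0}$ when $n=2$) are $0$. *)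

theory Defs
  imports "HOL-Analysis.Analysis"
begin

abbreviation unit_disk :: "complex set"
  where "unit_disk \<equiv> ball 0 1"

text \<open>
  \<open>f(z) = z + (\<Sum>n\<ge>2. a n * z ^ n)\<close> on the unit disk. The values
  \<open>a 0\<close> and \<open>a 1\<close> are irrelevant.
\<close>

definition has_expansion :: "(complex \<Rightarrow> complex) \<Rightarrow> (nat \<Rightarrow> complex) \<Rightarrow> bool"
  where "has_expansion f a \<longleftrightarrow>
    (\<forall>z\<in>unit_disk. (\<lambda>n. a (n + 2) * z ^ (n + 2)) sums (f z - z))"

definition class_A :: "(complex \<Rightarrow> complex) set"
  where "class_A = {f. f analytic_on unit_disk \<and> (\<exists>a. has_expansion f a)}"

definition log_quot :: "(complex \<Rightarrow> complex) \<Rightarrow> (complex \<Rightarrow> complex) \<Rightarrow> complex \<Rightarrow> complex"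
  where "log_quot h g z = (if z = 0 then 1 else z * deriv h z / g z)"

text \<open>
  The condition \<open>g z \<noteq> 0\<close> says that the quotient is defined off the origin; it has to be
  explicit because division by zero yields zero, which would satisfy the bounds
  when \<open>\<delta> < 0\<close>.
\<close>

definition class_S :: "real \<Rightarrow> real \<Rightarrow> (complex \<Rightarrow> complex) set"
  where "class_S \<delta> \<beta> = {g \<in> class_A.
    (\<forall>z\<in>unit_disk - {0}. g z \<noteq> 0) \<and>
    (\<forall>z\<in>unit_disk. \<delta> < Re (log_quot g g z) \<and> Re (log_quot g g z) < \<beta>)}"

text \<open>Intended for \<open>g \<in> class_S \<delta> \<beta>\<close>, so that \<open>g\<close> does not vanish off the origin.\<close>

definition class_Sg :: "(complex \<Rightarrow> complex) \<Rightarrow> real \<Rightarrow> real \<Rightarrow> (complex \<Rightarrow> complex) set"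
  where "class_Sg g \<alpha> \<beta> = {\<phi> \<in> class_A.
    \<forall>z\<in>unit_disk. \<alpha> < Re (log_quot \<phi> g z) \<and> Re (log_quot \<phi> g z) < \<beta>}"

definition class_Bg ::
    "(complex \<Rightarrow> complex) \<Rightarrow> real \<Rightarrow> real \<Rightarrow> real \<Rightarrow> (complex \<Rightarrow> complex) set"
  where "class_Bg g \<alpha> \<beta> \<rho> = {f \<in> class_A. \<exists>\<phi>\<in>class_Sg g \<alpha> \<beta>. \<forall>z\<in>unit_disk.
    z ^ 2 * (deriv ^^ 2) f z
      + 2 * (1 + of_real \<rho>) * z * deriv f z
      + of_real \<rho> * (1 + of_real \<rho>) * f z
    = (1 + of_real \<rho>) * (2 + of_real \<rho>) * \<phi> z}"

end

theory Submission
  imports Defs "HOL-Complex_Analysis.Complex_Analysis"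
begin

text \<open>
  The whole estimate rests on one fact: if \<open>p\<close> is holomorphic on the unit disk with \<open>p 0 = 1\<close>
  and \<open>a < Re p < b\<close>, then every later Taylor coefficient of \<open>p\<close> has modulus at most
  \<open>2 (b - a) / \<pi> * sin (\<pi> (1 - a) / (b - a))\<close>. For the first coefficient this is the Schwarz lemma
  after mapping the strip onto the disk (\<open>deriv_bound_strip\<close>). The strip is convex, so averaging
  \<open>p\<close> over the rotations by \<open>n\<close>-th roots of unity keeps the values in it; the average is a function
  of \<open>z ^ n\<close> whose first coefficient is the \<open>n\<close>-th one of \<open>p\<close> (\<open>coeff_bound_strip\<close>).

  Let \<open>P\<close> and \<open>Q\<close> be this bound for the strips \<open>(\<delta>, \<beta>)\<close> and \<open>(\<alpha>, \<beta>)\<close>. Comparing coefficients in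
  \<open>z g' = p g\<close> gives \<open>(n - 1) * t n = (\<Sum>k=1..n-1. p (n - k) * t k)\<close> for the coefficients \<open>t\<close>
  of \<open>g\<close>, so that they are majorised by the coefficients of \<open>z (1 - z) powr (-P)\<close>, which satisfy
  this recurrence with every \<open>p (n - k)\<close> replaced by \<open>P\<close> (\<open>class_S_coeff_bound\<close>). Comparing coefficients in \<open>z \<phi>' = q g\<close> then bounds the
  coefficients of \<open>\<phi>\<close>, and the Cauchy-Euler equation multiplies the \<open>n\<close>-th of these by
  \<open>(1 + \<rho>) (2 + \<rho>) / ((n + \<rho>) (n + 1 + \<rho>))\<close>.
\<close>

section \<open>Taylor coefficients of functions with values in a strip\<close>

lemma cmod_diff_less_cmod_diff_cnj:
  assumes "0 < Im w" "0 < Im v"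
  shows "cmod (w - v) < cmod (w - cnj v)"
proof -
  have "(cmod (w - v))\<^sup>2 < (cmod (w - cnj v))\<^sup>2"
    using mult_pos_pos[OF assms] by (simp add: cmod_power2) (simp add: power2_eq_square algebra_simps)
  then show ?thesis
    using power2_less_imp_less norm_ge_zero by blast
qed

text \<open>
  The exponential \<open>w\<close> below opens the strip to the upper half plane, and the Moebius map
  \<open>T\<close> takes this half plane to the disk and \<open>w 0\<close> to the origin. The bound is
  \<open>norm (deriv T 0) \<le> 1\<close>; the sine is the imaginary part of \<open>w 0\<close> relative to its modulus.
\<close>

lemma deriv_bound_strip:
  assumes holo: "p holomorphic_on ball 0 1"
    and strip: "\<And>z. z \<in> ball 0 1 \<Longrightarrow> a < Re (p z) \<and> Re (p z) < b"
  shows "norm (deriv p 0) \<le> 2 * (b - a) / pi * sin (pi * (Re (p 0) - a) / (b - a))"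
proof -
  define \<theta> where "\<theta> = pi * (Re (p 0) - a) / (b - a)"
  define w where "w z = exp (\<i> * of_real (pi / (b - a)) * (p z - of_real a))" for z
  define v where "v = w 0"
  define T where "T z = (w z - v) / (w z - cnj v)" for z
  have ab: "a < b" using strip[of 0] by simp
  have Im_w: "0 < Im (w z)" if "z \<in> ball 0 1" for z
  proof -
    have "0 < pi / (b - a) * (Re (p z) - a)"
      using strip[OF that] by simp
    moreover have "pi / (b - a) * (Re (p z) - a) < pi"
      using strip[OF that] by (simp add: field_simps)
    ultimately have "0 < sin (pi / (b - a) * (Re (p z) - a))"
      by (rule sin_gt_zero)
    then show ?thesis
      by (simp add: w_def Im_exp)
  qed
  have Im_v: "0 < Im v" unfolding v_def by (rule Im_w) simp
  have ne: "w z \<noteq> cnj v" if "z \<in> ball 0 1" for z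
    using Im_w[OF that] Im_v by (auto simp: complex_eq_iff)
  have holo_w: "w holomorphic_on ball 0 1"
    unfolding w_def by (intro holomorphic_intros holo)
  have holo_T: "T holomorphic_on ball 0 1"
    unfolding T_def by (intro holomorphic_intros holo_w) (use ne in auto)
  have T_less: "norm (T z) < 1" if "norm z < 1" for z
    using cmod_diff_less_cmod_diff_cnj[OF Im_w Im_v, of z] ne[of z] that
    by (simp add: T_def norm_divide)
  have "norm (deriv T 0) \<le> 1"
    by (rule Schwarz_Lemma(2)[OF holo_T _ T_less, of 0]) (auto simp: T_def v_def)
  have dp: "(p has_field_derivative deriv p 0) (at 0)"
    using holo by (intro holomorphic_derivI[of _ "ball 0 1"]) auto
  define d where "d = v * (\<i> * of_real (pi / (b - a)) * deriv p 0)"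
  have dw: "(w has_field_derivative d) (at 0)"
    unfolding w_def v_def d_def by (rule derivative_eq_intros dp refl)+ simp
  have "(T has_field_derivative d / (v - cnj v)) (at 0)"
    unfolding T_def
    by (rule derivative_eq_intros dw refl)+ (use ne[of 0] in \<open>simp_all add: v_def\<close>)
  then have T': "deriv T 0 = d / (v - cnj v)"
    by (rule DERIV_imp_deriv)
  have v_ne: "v \<noteq> 0" using Im_v by auto
  have "Im v = norm v * sin \<theta>"
    by (simp add: v_def w_def Im_exp \<theta>_def)
  then have nv: "norm (v - cnj v) = 2 * norm v * sin \<theta>"
    using Im_v unfolding complex_diff_cnj by (simp only: norm_mult norm_of_real norm_ii)
  have sin_pos: "0 < sin \<theta>"
    using Im_v v_ne \<open>Im v = norm v * sin \<theta>\<close> by (simp add: zero_less_mult_iff)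
  have "norm d = norm v * (pi / (b - a) * norm (deriv p 0))"
    using ab by (simp add: d_def norm_mult del: of_real_divide)
  then have "norm (deriv T 0) = pi * norm (deriv p 0) / (2 * (b - a) * sin \<theta>)"
    unfolding T' norm_divide nv using v_ne by simp
  moreover have "0 < 2 * (b - a) * sin \<theta>"
    using ab sin_pos by simp
  ultimately have "pi * norm (deriv p 0) \<le> 2 * (b - a) * sin \<theta>"
    using \<open>norm (deriv T 0) \<le> 1\<close> by (simp add: divide_le_eq)
  then show ?thesis
    unfolding \<theta>_def[symmetric] by (simp add: le_divide_eq mult.commute)
qed

lemma sum_roots_of_unity_power:
  assumes "n > 0"
  shows "(\<Sum>k<n. exp (2 * of_real pi * \<i> / of_nat n) ^ (k * j)) = (if n dvd j then of_nat n else 0 :: complex)"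
proof -
  define u where "u = exp (2 * of_real pi * \<i> / of_nat n :: complex) ^ j"
  have u: "u = exp (2 * of_real pi * \<i> * of_nat j / of_nat n)"
    unfolding u_def by (simp flip: exp_of_nat_mult add: mult_ac)
  have "u ^ n = 1" "u = 1 \<longleftrightarrow> n dvd j"
    unfolding u using assms complex_root_unity[of n j] complex_root_unity_eq_1[of n j] by simp_all
  moreover have "(\<Sum>k<n. exp (2 * of_real pi * \<i> / of_nat n) ^ (k * j)) = (\<Sum>k<n. u ^ k)"
    unfolding u_def by (simp add: mult.commute flip: power_mult)
  ultimately show ?thesis by (simp add: sum_gp_strict)
qed

text \<open>
  Averaging over the rotations by \<open>n\<close>-th roots of unity annihilates every monomial whose degree is
  not a multiple of \<open>n\<close>.
\<close>

lemma sums_average_rotations: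
  fixes c :: "nat \<Rightarrow> complex"
  assumes sums: "\<And>z. z \<in> ball 0 1 \<Longrightarrow> (\<lambda>j. c j * z ^ j) sums p z"
    and n: "n > 0" and z: "z \<in> ball 0 1"
  shows "(\<lambda>m. c (n * m) * (z ^ n) ^ m) sums
    ((\<Sum>k<n. p (exp (2 * of_real pi * \<i> / of_nat n) ^ k * z)) / of_nat n)"
proof -
  define \<omega> where "\<omega> = exp (2 * of_real pi * \<i> / of_nat n :: complex)"
  have "norm \<omega> = 1" by (simp add: \<omega>_def)
  then have "(\<lambda>j. c j * (\<omega> ^ k * z) ^ j) sums p (\<omega> ^ k * z)" for k
    using z by (intro sums) (simp add: norm_mult norm_power)
  then have "(\<lambda>j. (\<Sum>k<n. c j * (\<omega> ^ k * z) ^ j) / of_nat n) sums ((\<Sum>k<n. p (\<omega> ^ k * z)) / of_nat n)"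
    by (intro sums_divide sums_sum)
  moreover have "(\<Sum>k<n. c j * (\<omega> ^ k * z) ^ j) / of_nat n = (if n dvd j then c j * z ^ j else 0)" for j
  proof -
    have "(\<Sum>k<n. c j * (\<omega> ^ k * z) ^ j) = c j * z ^ j * (\<Sum>k<n. \<omega> ^ (k * j))"
      by (simp add: sum_distrib_left power_mult_distrib mult_ac flip: power_mult)
    then show ?thesis
      using n by (simp add: \<omega>_def sum_roots_of_unity_power)
  qed
  ultimately have *: "(\<lambda>j. if n dvd j then c j * z ^ j else 0) sums ((\<Sum>k<n. p (\<omega> ^ k * z)) / of_nat n)"
    by simp
  have "strict_mono (\<lambda>m. n * m)"
    using n by (simp add: strict_mono_def)
  from sums_mono_reindex[OF this, of "\<lambda>j. if n dvd j then c j * z ^ j else 0"] *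
  show ?thesis
    by (auto simp: \<omega>_def power_mult image_iff dvd_def)
qed

text \<open>
  The higher coefficients obey the bound of the first one because the average
  in \<open>sums_average_rotations\<close> is a function \<open>q\<close> of \<open>z ^ n\<close>, takes values in the same convex strip,
  and has derivative \<open>fps_nth P n\<close> at the origin.
\<close>

lemma coeff_bound_strip:
  assumes holo: "p holomorphic_on ball 0 1"
    and strip: "\<And>z. z \<in> ball 0 1 \<Longrightarrow> a < Re (p z) \<and> Re (p z) < b"
    and P: "p has_fps_expansion P" and n: "n > 0"
  shows "norm (fps_nth P n) \<le> 2 * (b - a) / pi * sin (pi * (Re (p 0) - a) / (b - a))"
proof -
  define Q where "Q = Abs_fps (\<lambda>m. fps_nth P (n * m))"
  define q where "q w = (\<Sum>m. fps_nth Q m * w ^ m)" for w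
  have sums: "(\<lambda>j. fps_nth P j * z ^ j) sums p z" if "z \<in> ball 0 1" for z
    using holomorphic_power_series[OF holo that] by (simp add: fps_nth_fps_expansion[OF P])
  have q: "(\<lambda>m. fps_nth Q m * w ^ m) sums q w \<and> a < Re (q w) \<and> Re (q w) < b"
    if w: "w \<in> ball 0 1" for w
  proof -
    obtain z where z: "w = z ^ n"
      using exists_complex_root n by blast
    then have "norm z < 1"
      using w n by (simp add: norm_power power_less_one_iff)
    define r where "r k = exp (2 * of_real pi * \<i> / of_nat n) ^ k * z" for k
    have r: "r k \<in> ball 0 1" for k
      using \<open>norm z < 1\<close> by (simp add: r_def norm_mult norm_power)
    have s: "(\<lambda>m. fps_nth Q m * w ^ m) sums ((\<Sum>k<n. p (r k)) / of_nat n)"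
      using sums_average_rotations[OF sums n, of z] \<open>norm z < 1\<close> by (simp add: Q_def z r_def)
    then have qw: "q w = (\<Sum>k<n. p (r k)) / of_nat n"
      by (simp add: q_def sums_iff)
    have "(\<Sum>k<n. a) < (\<Sum>k<n. Re (p (r k)))" "(\<Sum>k<n. Re (p (r k))) < (\<Sum>k<n. b)"
      using n strip[OF r] by (intro sum_strict_mono; auto)+
    then have "a < Re (q w)" "Re (q w) < b"
      using n by (simp_all add: qw Re_divide_of_nat field_simps)
    with s qw show ?thesis by simp
  qed
  have holo_q: "q holomorphic_on ball 0 1"
    by (rule power_series_holomorphic[of 0 1 "fps_nth Q"]) (use q in simp)
  have "eventually (\<lambda>w. w \<in> ball (0::complex) 1) (nhds 0)"
    by (rule eventually_nhds_in_open) auto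
  then have Q: "q has_fps_expansion Q"
    by (intro has_fps_expansionI) (use q in \<open>auto elim!: eventually_mono\<close>)
  have "q 0 = p 0"
    using fps_nth_fps_expansion[OF Q, of 0] fps_nth_fps_expansion[OF P, of 0] by (simp add: Q_def)
  moreover have "deriv q 0 = fps_nth P n"
    using fps_nth_fps_expansion[OF Q, of 1] by (simp add: Q_def)
  ultimately show ?thesis
    using deriv_bound_strip[OF holo_q, of a b] q by simp
qed

section \<open>The extremal recurrence\<close>

text \<open>
  For \<open>n \<ge> 1\<close>, the \<open>n\<close>-th Taylor coefficient of \<open>z (1 - z) powr (-P)\<close>; the Koebe function is the
  case \<open>P = 2\<close>.
\<close>

definition koebe_coeff :: "real \<Rightarrow> nat \<Rightarrow> real"
  where "koebe_coeff P n = (\<Prod>k=2..n. real k - 2 + P) / fact (n - 1)"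

text \<open>
  The function \<open>h z = z (1 - z) powr (-P)\<close> satisfies \<open>z h' - h = P z / (1 - z) * h\<close>; these are the
  coefficients of degree \<open>n + 1\<close> on both sides.
\<close>

lemma sum_koebe_coeff: "P * (\<Sum>k=1..n. koebe_coeff P k) = real n * koebe_coeff P (Suc n)"
proof (induction n)
  case (Suc n)
  define X where "X = (\<Prod>k=2..Suc n. real k - 2 + P)"
  have X: "(\<Prod>k=2..Suc (Suc n). real k - 2 + P) = (real n + P) * X"
    unfolding X_def by (subst prod.nat_ivl_Suc') auto
  have step: "(real n + 1) * koebe_coeff P (Suc (Suc n)) = (real n + P) * koebe_coeff P (Suc n)"
    unfolding koebe_coeff_def X X_def[symmetric]
    by (simp add: divide_simps)
  have "P * (\<Sum>k=1..Suc n. koebe_coeff P k) = (real n + P) * koebe_coeff P (Suc n)"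
    using Suc by (simp add: algebra_simps)
  then show ?case using step by (simp add: add.commute)
qed simp

lemma koebe_coeff_majorant:
  fixes c :: "nat \<Rightarrow> real"
  assumes "0 \<le> P" "c 1 \<le> 1"
    and rec: "\<And>n. 2 \<le> n \<Longrightarrow> real (n - 1) * c n \<le> P * (\<Sum>k=1..n-1. c k)"
    and "1 \<le> n"
  shows "c n \<le> koebe_coeff P n"
  using \<open>1 \<le> n\<close>
proof (induction n rule: less_induct)
  case (less n)
  show ?case
  proof (cases "n = 1")
    case True
    then show ?thesis using assms by (simp add: koebe_coeff_def)
  next
    case False
    then have n: "2 \<le> n" using less.prems by simp
    have "real (n - 1) * c n \<le> P * (\<Sum>k=1..n-1. c k)"
      by (rule rec[OF n])
    also have "\<dots> \<le> P * (\<Sum>k=1..n-1. koebe_coeff P k)"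
      using n by (intro mult_left_mono sum_mono less.IH assms) auto
    also have "\<dots> = real (n - 1) * koebe_coeff P n"
      using n sum_koebe_coeff[of P "n - 1"] by simp
    finally show ?thesis using n by simp
  qed
qed

section \<open>Coefficient relations for the quotients and the differential equation\<close>

text \<open>
  In \<^const>\<open>has_expansion\<close> the coefficients of degree 0 and 1 are 0 and 1 whatever the
  sequence says there.
\<close>

definition expansion_fps :: "(nat \<Rightarrow> complex) \<Rightarrow> complex fps"
  where "expansion_fps a = Abs_fps (\<lambda>n. if n < 2 then of_nat n else a n)"

lemma has_fps_expansion_expansion_fps:
  assumes "has_expansion f a"
  shows "f has_fps_expansion expansion_fps a"
proof (rule has_fps_expansionI)
  have "eventually (\<lambda>z. z \<in> unit_disk) (nhds 0)"
    by (rule eventually_nhds_in_open) auto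
  then show "\<forall>\<^sub>F z in nhds 0. (\<lambda>n. fps_nth (expansion_fps a) n * z ^ n) sums f z"
  proof eventually_elim
    case (elim z)
    then have "(\<lambda>n. a (n + 2) * z ^ (n + 2)) sums (f z - z)"
      using assms by (simp add: has_expansion_def)
    then have "(\<lambda>n. fps_nth (expansion_fps a) (n + 2) * z ^ (n + 2)) sums (f z - z)"
      by (simp add: expansion_fps_def)
    then show ?case
      by (subst (asm) sums_iff_shift) (simp add: expansion_fps_def numeral_2_eq_2)
  qed
qed

text \<open>
  Dividing \<open>g\<close> by \<open>z\<close> removes its only zero and turns the quotient into \<open>h' / (g / z)\<close>, which is
  also correct at the origin: there \<open>h' = 1\<close> and \<open>g / z\<close> continues to 1, in agreement with the
  prescribed value 1.
\<close>

lemma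
  assumes "h \<in> class_A" "g \<in> class_A" "\<forall>z\<in>unit_disk - {0}. g z \<noteq> 0"
    and H: "h has_fps_expansion expansion_fps b" and G: "g has_fps_expansion expansion_fps c"
  shows holomorphic_log_quot: "log_quot h g holomorphic_on unit_disk"
    and log_quot_fps: "fps_expansion (log_quot h g) 0 * fps_shift 1 (expansion_fps c) = fps_deriv (expansion_fps b)"
proof -
  define g1 where "g1 z = (if z = 0 then 1 else g z / z)" for z
  have G1: "g1 has_fps_expansion fps_shift 1 (expansion_fps c)"
  proof -
    have "expansion_fps c \<noteq> 0"
      by (auto simp: expansion_fps_def fps_eq_iff intro!: exI[of _ 1])
    then have "1 \<le> subdegree (expansion_fps c)"
      by (intro subdegree_geI) (auto simp: expansion_fps_def)
    then show ?thesis
      using has_fps_expansion_shift[OF G, of 1 1]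
      by (simp add: g1_def[abs_def] expansion_fps_def cong: if_cong)
  qed
  have holo_g: "g holomorphic_on unit_disk" and holo_h: "h holomorphic_on unit_disk"
    using assms by (auto simp: class_A_def analytic_on_open)
  have "(\<lambda>z. g z / z) holomorphic_on unit_disk - {0}"
    by (intro holomorphic_intros holomorphic_on_subset[OF holo_g]) auto
  then have "g1 holomorphic_on unit_disk - {0}"
    by (rule holomorphic_transform) (simp add: g1_def)
  then have "g1 analytic_on unit_disk - {0}"
    by (subst analytic_on_open) (auto intro: open_delete)
  moreover have "g1 analytic_on {0}"
    by (rule has_fps_expansion_imp_analytic_0[OF G1])
  ultimately have "g1 analytic_on (unit_disk - {0}) \<union> {0}"
    by (simp only: analytic_on_Un)
  then have holo_g1: "g1 holomorphic_on unit_disk"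
    by (rule holomorphic_on_subset[OF analytic_imp_holomorphic]) auto
  have g1_ne: "g1 z \<noteq> 0" if "z \<in> unit_disk" for z
    using that assms(3) by (auto simp: g1_def)
  have "deriv h 0 = 1"
    using fps_nth_fps_expansion[OF H, of 1] by (simp add: expansion_fps_def)
  then have eq: "log_quot h g z = deriv h z / g1 z" for z
    by (simp add: log_quot_def g1_def)
  show holo: "log_quot h g holomorphic_on unit_disk"
    unfolding eq[abs_def] by (intro holomorphic_intros holo_g1 holo_h) (use g1_ne in auto)
  have "(\<lambda>z. log_quot h g z * g1 z) has_fps_expansion
      fps_expansion (log_quot h g) 0 * fps_shift 1 (expansion_fps c)"
    by (intro has_fps_expansion_mult G1 has_fps_expansion_fps_expansion[OF _ _ holo]) auto
  moreover have "eventually (\<lambda>z. z \<in> unit_disk) (nhds 0)"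
    by (rule eventually_nhds_in_open) auto
  then have "eventually (\<lambda>z. log_quot h g z * g1 z = deriv h z) (nhds 0)"
    by eventually_elim (use g1_ne in \<open>auto simp: eq\<close>)
  ultimately have "deriv h has_fps_expansion
      fps_expansion (log_quot h g) 0 * fps_shift 1 (expansion_fps c)"
    using has_fps_expansion_cong[OF _ refl] iffD1 by fast
  then show "fps_expansion (log_quot h g) 0 * fps_shift 1 (expansion_fps c) = fps_deriv (expansion_fps b)"
    using has_fps_expansion_deriv[OF H] fps_expansion_unique_complex by blast
qed

text \<open>
  The second clause compares the coefficients of \<open>z ^ n\<close> in \<open>z h' = q g\<close>. The summands for \<open>k = n\<close> and
  \<open>k = 1\<close> stand apart: the former because \<open>q\<close> has constant term 1, the latter because the
  first coefficient of \<open>g\<close> is 1 but need not be \<open>t 1\<close>.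
\<close>

lemma log_quot_strip:
  assumes "h \<in> class_A" "g \<in> class_A" "\<forall>z\<in>unit_disk - {0}. g z \<noteq> 0"
    and strip: "\<forall>z\<in>unit_disk. a < Re (log_quot h g z) \<and> Re (log_quot h g z) < b"
    and H: "has_expansion h s" and G: "has_expansion g t"
  shows "\<exists>q. (\<forall>j>0. norm (q j) \<le> 2 * (b - a) / pi * sin (pi * (1 - a) / (b - a))) \<and>
    (\<forall>n\<ge>2. of_nat n * s n = t n + (\<Sum>k=2..n-1. q (n - k) * t k) + q (n - 1))"
proof -
  note H' = has_fps_expansion_expansion_fps[OF H] and G' = has_fps_expansion_expansion_fps[OF G]
  define Q where "Q = fps_expansion (log_quot h g) 0"
  have holo: "log_quot h g holomorphic_on unit_disk"
    by (rule holomorphic_log_quot[OF assms(1-3) H' G'])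
  have Q: "log_quot h g has_fps_expansion Q"
    unfolding Q_def by (rule has_fps_expansion_fps_expansion[OF _ _ holo]) auto
  have one: "log_quot h g 0 = 1" by (simp add: log_quot_def)
  show ?thesis
  proof (intro exI[of _ "fps_nth Q"] conjI allI impI)
    show "norm (fps_nth Q j) \<le> 2 * (b - a) / pi * sin (pi * (1 - a) / (b - a))" if "0 < j" for j
      using coeff_bound_strip[OF holo _ Q that, of a b] strip one by simp
  next
    fix n :: nat assume n: "2 \<le> n"
    have Q0: "fps_nth Q 0 = 1"
      using fps_nth_fps_expansion[OF Q, of 0] one by simp
    have "of_nat n * s n = fps_nth (fps_deriv (expansion_fps s)) (n - 1)"
      using n by (simp add: expansion_fps_def)
    also have "\<dots> = (\<Sum>i=0..n-1. fps_nth Q i * fps_nth (expansion_fps t) (n - i))"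
      unfolding log_quot_fps[OF assms(1-3) H' G', symmetric] Q_def[symmetric]
      using n by (auto simp: fps_mult_nth intro!: sum.cong arg_cong[where f = "fps_nth _"])
    also have "\<dots> = (\<Sum>k=1..n. fps_nth Q (n - k) * fps_nth (expansion_fps t) k)"
      by (rule sum.reindex_bij_witness[of _ "\<lambda>k. n - k" "\<lambda>k. n - k"]) (use n in auto)
    also have "{1..n} = insert n (insert 1 {2..n-1})"
      using n by auto
    also have "(\<Sum>k\<in>\<dots>. fps_nth Q (n - k) * fps_nth (expansion_fps t) k)
      = t n + (fps_nth Q (n - 1) + (\<Sum>k=2..n-1. fps_nth Q (n - k) * fps_nth (expansion_fps t) k))"
      using n by (subst sum.insert; simp add: Q0 expansion_fps_def)+
    also have "(\<Sum>k=2..n-1. fps_nth Q (n - k) * fps_nth (expansion_fps t) k)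
      = (\<Sum>k=2..n-1. fps_nth Q (n - k) * t k)"
      by (intro sum.cong) (auto simp: expansion_fps_def)
    finally show "of_nat n * s n = t n + (\<Sum>k=2..n-1. fps_nth Q (n - k) * t k) + fps_nth Q (n - 1)"
      by simp
  qed
qed

text \<open>
  The Euler operator acts diagonally on powers: it multiplies \<open>z ^ n\<close> by
  \<open>n (n - 1) + 2 (1 + \<rho>) n + \<rho> (1 + \<rho>)\<close>, which factors as \<open>(n + \<rho>) (n + 1 + \<rho>)\<close>.
\<close>

lemma Cauchy_Euler_coeff:
  fixes \<rho> :: complex
  assumes F: "f has_fps_expansion F" and \<Phi>: "\<phi> has_fps_expansion \<Phi>"
    and ode: "\<forall>z\<in>unit_disk. z ^ 2 * (deriv ^^ 2) f z + 2 * (1 + \<rho>) * z * deriv f z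
      + \<rho> * (1 + \<rho>) * f z = (1 + \<rho>) * (2 + \<rho>) * \<phi> z"
  shows "(of_nat n + \<rho>) * (of_nat n + 1 + \<rho>) * fps_nth F n = (1 + \<rho>) * (2 + \<rho>) * fps_nth \<Phi> n"
proof -
  define L where "L = fps_X * (fps_X * fps_deriv (fps_deriv F))
    + fps_const (2 * (1 + \<rho>)) * (fps_X * fps_deriv F) + fps_const (\<rho> * (1 + \<rho>)) * F"
  have "(\<lambda>z. z * (z * deriv (deriv f) z) + 2 * (1 + \<rho>) * (z * deriv f z) + \<rho> * (1 + \<rho>) * f z)
      has_fps_expansion L"
    unfolding L_def by (intro has_fps_expansion_add has_fps_expansion_mult has_fps_expansion_deriv
        has_fps_expansion_fps_X has_fps_expansion_const F)
  moreover have "eventually (\<lambda>z. z \<in> unit_disk) (nhds 0)"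
    by (rule eventually_nhds_in_open) auto
  then have "eventually (\<lambda>z. z * (z * deriv (deriv f) z) + 2 * (1 + \<rho>) * (z * deriv f z)
      + \<rho> * (1 + \<rho>) * f z = (1 + \<rho>) * (2 + \<rho>) * \<phi> z) (nhds 0)"
    by eventually_elim (use ode in \<open>auto simp: numeral_2_eq_2 mult.assoc\<close>)
  ultimately have "(\<lambda>z. (1 + \<rho>) * (2 + \<rho>) * \<phi> z) has_fps_expansion L"
    using has_fps_expansion_cong[OF _ refl] iffD1 by fast
  moreover have "(\<lambda>z. (1 + \<rho>) * (2 + \<rho>) * \<phi> z) has_fps_expansion fps_const ((1 + \<rho>) * (2 + \<rho>)) * \<Phi>"
    by (intro has_fps_expansion_mult has_fps_expansion_const \<Phi>)
  ultimately have "L = fps_const ((1 + \<rho>) * (2 + \<rho>)) * \<Phi>"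
    using fps_expansion_unique_complex by blast
  then have "fps_nth L n = (1 + \<rho>) * (2 + \<rho>) * fps_nth \<Phi> n"
    by simp
  moreover have "fps_nth L n = (of_nat n + \<rho>) * (of_nat n + 1 + \<rho>) * fps_nth F n"
    by (cases n; cases "n - 1") (auto simp: L_def algebra_simps)
  ultimately show ?thesis by simp
qed

section \<open>The coefficient bounds\<close>

text \<open>
  With \<open>h = g\<close> in \<open>log_quot_strip\<close> the term \<open>t n\<close> occurs on both sides; cancelling it leaves a
  recurrence for \<open>t n\<close> in the earlier coefficients, whose extremal case is the Koebe recurrence.
\<close>

lemma class_S_coeff_bound:
  assumes "g \<in> class_S \<delta> \<beta>" "has_expansion g t" "2 \<le> n"
  shows "norm (t n) \<le> koebe_coeff (2 * (\<beta> - \<delta>) / pi * sin (pi * (1 - \<delta>) / (\<beta> - \<delta>))) n"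
proof -
  define P where "P = 2 * (\<beta> - \<delta>) / pi * sin (pi * (1 - \<delta>) / (\<beta> - \<delta>))"
  have g: "g \<in> class_A" "\<forall>z\<in>unit_disk - {0}. g z \<noteq> 0"
    "\<forall>z\<in>unit_disk. \<delta> < Re (log_quot g g z) \<and> Re (log_quot g g z) < \<beta>"
    using assms by (auto simp: class_S_def)
  obtain p where p: "\<And>j. 0 < j \<Longrightarrow> norm (p j) \<le> P"
    and rec: "\<And>n. 2 \<le> n \<Longrightarrow> of_nat n * t n = t n + (\<Sum>k=2..n-1. p (n - k) * t k) + p (n - 1)"
    using log_quot_strip[OF g(1,1,2,3) assms(2,2), folded P_def] by blast
  have P0: "0 \<le> P" using p[of 1] norm_ge_zero order_trans by (metis zero_less_one)
  \<comment> \<open>The sequence \<open>t\<close> with the true first coefficient of \<open>g\<close> put in place of \<open>t 1\<close>.\<close>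
  define c where "c k = (if k = 1 then 1 else norm (t k))" for k
  have "c n \<le> koebe_coeff P n"
  proof (rule koebe_coeff_majorant[OF P0])
    fix n :: nat assume n: "2 \<le> n"
    have "of_nat (n - 1) * t n = (\<Sum>k=2..n-1. p (n - k) * t k) + p (n - 1)"
      using rec[OF n] n by (simp add: of_nat_diff algebra_simps)
    then have "real (n - 1) * norm (t n) = norm ((\<Sum>k=2..n-1. p (n - k) * t k) + p (n - 1))"
      by (metis norm_mult norm_of_nat)
    also have "\<dots> \<le> (\<Sum>k=2..n-1. P * norm (t k)) + P"
      using n by (intro norm_triangle_mono sum_norm_le p) (auto simp: norm_mult intro!: mult_right_mono p)
    also have "\<dots> = P * (\<Sum>k\<in>insert 1 {2..n-1}. c k)"
      by (simp add: c_def sum_distrib_left distrib_left)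
    also have "insert 1 {2..n-1} = {1..n-1}"
      using n by auto
    finally show "real (n - 1) * c n \<le> P * (\<Sum>k=1..n-1. c k)"
      using n by (simp add: c_def)
  qed (use assms in \<open>auto simp: c_def\<close>)
  then show ?thesis
    using assms by (simp add: c_def P_def)
qed

theorem theorem3:
  fixes \<alpha> \<beta> \<delta> \<rho> :: real
    and f g :: "complex \<Rightarrow> complex"
    and a :: "nat \<Rightarrow> complex"
  assumes "0 \<le> \<alpha>" "\<alpha> < 1" "1 < \<beta>"
    and "0 \<le> \<delta>" "\<delta> < 1"
    and "g \<in> class_S \<delta> \<beta>"
    and "\<rho> \<notin> {..-1}"
    and "f \<in> class_A" "has_expansion f a"
    and "f \<in> class_Bg g \<alpha> \<beta> \<rho>"
  shows "\<forall>n\<ge>2. norm (a n) \<le>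
    ((\<Prod>k=2..n. real k - 2 + 2 * (\<beta> - \<delta>) / pi * sin (pi * (1 - \<delta>) / (\<beta> - \<delta>))) / fact n
      + 2 * (\<beta> - \<alpha>) / (real n * pi) * sin (pi * (1 - \<alpha>) / (\<beta> - \<alpha>)) *
        (1 + (\<Sum>j=1..n-2.
          (\<Prod>k=2..n-j. real k - 2 + 2 * (\<beta> - \<delta>) / pi * sin (pi * (1 - \<delta>) / (\<beta> - \<delta>)))
            / fact (n - j - 1))))
    * ((1 + \<rho>) * (2 + \<rho>) / ((real n + \<rho>) * (real n + 1 + \<rho>)))"
proof (intro allI impI)
  fix n :: nat assume n: "2 \<le> n"
  define P where "P = 2 * (\<beta> - \<delta>) / pi * sin (pi * (1 - \<delta>) / (\<beta> - \<delta>))"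
  define Q where "Q = 2 * (\<beta> - \<alpha>) / pi * sin (pi * (1 - \<alpha>) / (\<beta> - \<alpha>))"
  obtain t where t: "has_expansion g t"
    using assms by (auto simp: class_S_def class_A_def)
  obtain \<phi> where \<phi>: "\<phi> \<in> class_Sg g \<alpha> \<beta>"
    and ode: "\<forall>z\<in>unit_disk. z ^ 2 * (deriv ^^ 2) f z + 2 * (1 + of_real \<rho>) * z * deriv f z
      + of_real \<rho> * (1 + of_real \<rho>) * f z = (1 + of_real \<rho>) * (2 + of_real \<rho>) * \<phi> z"
    using assms by (auto simp: class_Bg_def)
  obtain s where s: "has_expansion \<phi> s"
    using \<phi> by (auto simp: class_Sg_def class_A_def)
  have g: "g \<in> class_A" "\<forall>z\<in>unit_disk - {0}. g z \<noteq> 0"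
    using assms by (auto simp: class_S_def)
  have \<phi>': "\<phi> \<in> class_A"
    "\<forall>z\<in>unit_disk. \<alpha> < Re (log_quot \<phi> g z) \<and> Re (log_quot \<phi> g z) < \<beta>"
    using \<phi> by (auto simp: class_Sg_def)
  obtain q where q: "\<And>j. 0 < j \<Longrightarrow> norm (q j) \<le> Q"
    and rec: "\<And>n. 2 \<le> n \<Longrightarrow> of_nat n * s n = t n + (\<Sum>k=2..n-1. q (n - k) * t k) + q (n - 1)"
    using log_quot_strip[OF \<phi>'(1) g \<phi>'(2) s t, folded Q_def] by blast
  have Q0: "0 \<le> Q" using q[of 1] norm_ge_zero order_trans by (metis zero_less_one)
  have t_bound: "norm (t k) \<le> koebe_coeff P k" if "2 \<le> k" for k
    using class_S_coeff_bound[of g \<delta> \<beta> t k] assms t that by (simp add: P_def)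
  have "real n * norm (s n) = norm (t n + (\<Sum>k=2..n-1. q (n - k) * t k) + q (n - 1))"
    by (metis rec[OF n] norm_mult norm_of_nat)
  also have "\<dots> \<le> koebe_coeff P n + (\<Sum>k=2..n-1. Q * koebe_coeff P k) + Q"
    using n Q0 by (intro norm_triangle_mono sum_norm_le q t_bound)
      (auto simp: norm_mult intro!: mult_mono q t_bound)
  also have "(\<Sum>k=2..n-1. Q * koebe_coeff P k) = (\<Sum>j=1..n-2. Q * koebe_coeff P (n - j))"
    by (rule sum.reindex_bij_witness[of _ "\<lambda>k. n - k" "\<lambda>k. n - k"]) auto
  finally have "norm (s n) \<le> (koebe_coeff P n + Q * (1 + (\<Sum>j=1..n-2. koebe_coeff P (n - j)))) / n"
    using n by (simp add: field_simps sum_distrib_left)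
  also have "\<dots> = koebe_coeff P n / n + Q / n * (1 + (\<Sum>j=1..n-2. koebe_coeff P (n - j)))"
    by (simp add: add_divide_distrib)
  also have "koebe_coeff P n / n = (\<Prod>k=2..n. real k - 2 + P) / fact n"
    using n by (simp add: koebe_coeff_def fact_reduce[of n] mult.commute)
  finally have s_bound: "norm (s n) \<le> (\<Prod>k=2..n. real k - 2 + P) / fact n
      + Q / n * (1 + (\<Sum>j=1..n-2. koebe_coeff P (n - j)))" .
  define K where "K = (1 + \<rho>) * (2 + \<rho>) / ((real n + \<rho>) * (real n + 1 + \<rho>))"
  have pos: "0 < 1 + \<rho>" "0 < 2 + \<rho>" "0 < real n + \<rho>" "0 < real n + 1 + \<rho>"
    using assms n by auto
  have "of_real ((real n + \<rho>) * (real n + 1 + \<rho>)) * a n = of_real ((1 + \<rho>) * (2 + \<rho>)) * s n"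
    using Cauchy_Euler_coeff[OF has_fps_expansion_expansion_fps[OF assms(9)]
        has_fps_expansion_expansion_fps[OF s] ode, of n] n
    by (simp add: expansion_fps_def)
  then have "(real n + \<rho>) * (real n + 1 + \<rho>) * norm (a n) = (1 + \<rho>) * (2 + \<rho>) * norm (s n)"
    using pos by (metis abs_of_pos mult_pos_pos norm_mult norm_of_real)
  then have "norm (a n) = (1 + \<rho>) * (2 + \<rho>) * norm (s n) / ((real n + \<rho>) * (real n + 1 + \<rho>))"
    using pos by (intro eq_divide_imp) (auto simp: mult_ac)
  then have "norm (a n) = norm (s n) * K"
    by (simp add: K_def)
  also have "\<dots> \<le> ((\<Prod>k=2..n. real k - 2 + P) / fact n
      + Q / n * (1 + (\<Sum>j=1..n-2. koebe_coeff P (n - j)))) * K"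
    using pos by (intro mult_right_mono s_bound) (simp add: K_def)
  finally show "norm (a n) \<le>
    ((\<Prod>k=2..n. real k - 2 + 2 * (\<beta> - \<delta>) / pi * sin (pi * (1 - \<delta>) / (\<beta> - \<delta>))) / fact n
      + 2 * (\<beta> - \<alpha>) / (real n * pi) * sin (pi * (1 - \<alpha>) / (\<beta> - \<alpha>)) *
        (1 + (\<Sum>j=1..n-2.
          (\<Prod>k=2..n-j. real k - 2 + 2 * (\<beta> - \<delta>) / pi * sin (pi * (1 - \<delta>) / (\<beta> - \<delta>)))
            / fact (n - j - 1))))
    * ((1 + \<rho>) * (2 + \<rho>) / ((real n + \<rho>) * (real n + 1 + \<rho>)))"
    unfolding P_def[symmetric] K_def[symmetric] by (simp add: koebe_coeff_def Q_def mult.commute)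
qed

end
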